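(* Let $n\geq 4$ be an integer and let $f\in C_0^\infty(\mathbb{R}^n\setminus\{0\})$ (complex-valued). Then $$\operatorname{Re}\,\langle \Delta_r f, \Delta_s f\rangle\geq 0,$$ and hence $$\|\Delta f\|_2^2\geq \|\Delta_r f\|_2^2+\|\Delta_s f\|_2^2,$$ where $\Delta$ is the Laplacian on $\mathbb{R}^n$, and $\Delta_r$ and $\Delta_s=\frac{1}{|x|^2}\Delta_{\mathbb{S}^{n-1}}$ are its radial and spherical parts.
   Context: $|\cdot|$ is the Euclidean norm on $\mathbb{R}^n$; $\langle\cdot,\cdot\rangle$ and $\|\cdot\|_2$ are the inner product and norm of $L^2(\mathbb{R}^n)$ (Lebesgue measure). $C_0^\infty(\mathbb{R}^n\setminus\{0\})$ is the space of smooth functions with compact support in $\mathbb{R}^n\setminus\{0\}$. The radial derivative is $\partial_r=\frac{x}{|x|}\cdot\nabla$, and the radial Laplacian is $\Delta_r=\partial_r^2+\frac{n-1}{|x|}\partial_r$. $\Delta_{\mathbb{S}^{n-1}}$ is the Laplace-Beltrami operator on the unit sphere $\mathbb{S}^{n-1}$ (acting in the angular variable $x/|x|$). The spherical part is $$\Delta_s=\frac{1}{|x|^2}\Delta_{\mathbb{S}^{n-1}}=\sum_{j=1}^n L_j^2,\qquad L_j=\partial_j-\frac{x_j}{|x|}\partial_r,\quad j=1,\dots,n,$$ so that $\Delta=\Delta_r+\Delta_s$ on $\mathbb{R}^n\setminus\{0\}$. *)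

theory Defs
  imports "HOL-Analysis.Analysis"
begin

definition partial :: "'n::finite \<Rightarrow> (real^'n \<Rightarrow> complex) \<Rightarrow> real^'n \<Rightarrow> complex"
  where "partial j f x = frechet_derivative f (at x) (axis j 1)"

fun Ck :: "nat \<Rightarrow> (real^'n::finite \<Rightarrow> complex) \<Rightarrow> bool" where
  "Ck 0 f \<longleftrightarrow> continuous_on UNIV f"
| "Ck (Suc k) f \<longleftrightarrow> (\<forall>x. f differentiable (at x)) \<and> (\<forall>j. Ck k (partial j f))"

definition smooth :: "(real^'n::finite \<Rightarrow> complex) \<Rightarrow> bool"
  where "smooth f \<longleftrightarrow> (\<forall>k. Ck k f)"

text \<open>Smooth functions with compact support in the punctured space. As usual, such a function is
  identified with its extension by zero to the whole space.\<close>

definition test_functions :: "(real^'n::finite \<Rightarrow> complex) set"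
  where "test_functions =
    {f. smooth f \<and> compact (closure {x. f x \<noteq> 0}) \<and> closure {x. f x \<noteq> 0} \<subseteq> - {0}}"

text \<open>The operators below have singular coefficients at the origin, where division by zero gives
  the value 0. This is harmless: test functions, and hence all the derivatives below, vanish near
  the origin. The spherical part is the sum of squares of the operators
  $L_j = \partial_j - (x_j/|x|)\,\partial_r$, here \<open>angular_deriv j\<close>; away from the origin it equals
  $|x|^{-2}$ times the Laplace--Beltrami operator in the angular variable
  (\<open>spherical_laplacian_eq_beltrami\<close>) and $\Delta - \Delta_r$ (\<open>laplacian_split\<close>).\<close>

definition radial_deriv :: "(real^'n::finite \<Rightarrow> complex) \<Rightarrow> real^'n \<Rightarrow> complex"
  where "radial_deriv f x = (\<Sum>j\<in>UNIV. (x $ j / norm x) *\<^sub>R partial j f x)"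

definition radial_laplacian :: "(real^'n::finite \<Rightarrow> complex) \<Rightarrow> real^'n \<Rightarrow> complex"
  where "radial_laplacian f x =
    radial_deriv (radial_deriv f) x + ((real CARD('n) - 1) / norm x) *\<^sub>R radial_deriv f x"

definition angular_deriv :: "'n::finite \<Rightarrow> (real^'n \<Rightarrow> complex) \<Rightarrow> real^'n \<Rightarrow> complex"
  where "angular_deriv j f x = partial j f x - (x $ j / norm x) *\<^sub>R radial_deriv f x"

definition spherical_laplacian :: "(real^'n::finite \<Rightarrow> complex) \<Rightarrow> real^'n \<Rightarrow> complex"
  where "spherical_laplacian f x = (\<Sum>j\<in>UNIV. angular_deriv j (angular_deriv j f) x)"

definition laplacian :: "(real^'n::finite \<Rightarrow> complex) \<Rightarrow> real^'n \<Rightarrow> complex"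
  where "laplacian f x = (\<Sum>j\<in>UNIV. partial j (partial j f) x)"

text \<open>The Laplace--Beltrami operator of the unit sphere, at a point of the sphere: the Euclidean
  Laplacian of the extension that is constant along rays.\<close>

definition sphere_laplace_beltrami :: "(real^'n::finite \<Rightarrow> complex) \<Rightarrow> real^'n \<Rightarrow> complex"
  where "sphere_laplace_beltrami g w = laplacian (\<lambda>y. g (y /\<^sub>R norm y)) w"

text \<open>All functions these are applied to are continuous with compact support, so the Bochner
  integrals exist.\<close>

definition l2_inner :: "(real^'n::finite \<Rightarrow> complex) \<Rightarrow> (real^'n \<Rightarrow> complex) \<Rightarrow> complex"
  where "l2_inner u v = (\<integral>x. u x * cnj (v x) \<partial>lborel)"

definition l2_norm :: "(real^'n::finite \<Rightarrow> complex) \<Rightarrow> real"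
  where "l2_norm u = sqrt (\<integral>x. (cmod (u x))\<^sup>2 \<partial>lborel)"

lemma partial_eq:
  assumes "(f has_derivative D) (at x)"
  shows "partial j f x = D (axis j 1)"
  using frechet_derivative_at[OF assms] by (simp add: partial_def)

lemma sum_axis: "(\<Sum>j\<in>UNIV. (v $ j) *\<^sub>R axis j 1) = (v :: real^'n::finite)"
  using basis_expansion[of v] by (simp add: scalar_mult_eq_scaleR)

lemma radial_deriv_eq:
  assumes "(f has_derivative D) (at x)"
  shows "radial_deriv f x = D (x /\<^sub>R norm x)"
proof -
  interpret D: linear D using assms has_derivative_linear by blast
  have "D (x /\<^sub>R norm x) = D (\<Sum>j\<in>UNIV. (x $ j / norm x) *\<^sub>R axis j 1)"
    using sum_axis[of "x /\<^sub>R norm x"] by (simp add: divide_inverse mult.commute)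
  then show ?thesis
    by (simp add: radial_deriv_def partial_eq[OF assms] D.sum D.scale)
qed

lemma angular_deriv_eq:
  assumes "(f has_derivative D) (at x)"
  shows "angular_deriv j f x = D (axis j 1 - (x $ j / norm x) *\<^sub>R (x /\<^sub>R norm x))"
proof -
  interpret D: linear D using assms has_derivative_linear by blast
  show ?thesis
    unfolding angular_deriv_def radial_deriv_eq[OF assms] partial_eq[OF assms]
    by (simp only: D.diff D.scale)
qed

lemma has_derivative_direction:
  assumes "x \<noteq> (0 :: real^'n::finite)"
  shows "((\<lambda>y. y $ j / norm y) has_derivative
    (\<lambda>h. h $ j / norm x - x $ j * (x \<bullet> h) / norm x ^ 3)) (at x)"
proof -
  have 1: "((\<lambda>y. y $ j) has_derivative (\<lambda>h. h $ j)) (at x)"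
    by (rule bounded_linear_imp_has_derivative[OF bounded_linear_vec_nth])
  show ?thesis
    by (rule has_derivative_eq_rhs[OF has_derivative_divide[OF 1 has_derivative_norm[OF assms]]])
      (use assms in \<open>auto simp: fun_eq_iff sgn_div_norm inner_commute field_simps power3_eq_cube\<close>)
qed

lemma angular_vectors:
  assumes "x \<noteq> (0 :: real^'n::finite)"
  shows "(\<Sum>j\<in>UNIV. (x $ j / norm x) *\<^sub>R (axis j 1 - (x $ j / norm x) *\<^sub>R (x /\<^sub>R norm x))) = 0"
proof -
  let ?e = "x /\<^sub>R norm x"
  have n: "norm ?e = 1" using assms by simp
  have e: "x $ j / norm x = ?e $ j" for j by (simp add: divide_inverse mult.commute)
  have "(\<Sum>j\<in>UNIV. (?e $ j) *\<^sub>R (axis j 1 - (?e $ j) *\<^sub>R ?e)) =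
     (\<Sum>j\<in>UNIV. (?e $ j) *\<^sub>R axis j 1) - (\<Sum>j\<in>UNIV. ?e $ j * ?e $ j) *\<^sub>R ?e"
    by (simp only: scaleR_diff_right sum_subtractf scaleR_scaleR scaleR_sum_left sum_distrib_right
        mult.assoc)
  also have "(\<Sum>j\<in>UNIV. ?e $ j * ?e $ j) = ?e \<bullet> ?e"
    by (simp only: inner_vec_def inner_real_def)
  also have "\<dots> = 1" using n by (simp only: dot_square_norm) simp
  finally show ?thesis unfolding e by (simp only: sum_axis) simp
qed

context
  fixes f :: "real^'n::finite \<Rightarrow> complex"
  assumes C2: "Ck 2 f"
begin

lemma C2_differentiable:
  "f differentiable (at x)" "partial j f differentiable (at x)"
  using C2 by (auto simp: numeral_2_eq_2)

lemma angular_differentiable: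
  assumes "x \<noteq> 0"
  obtains R where "(radial_deriv f has_derivative R) (at x)"
    "R (x /\<^sub>R norm x) =
       (\<Sum>j\<in>UNIV. (x $ j / norm x) *\<^sub>R frechet_derivative (partial j f) (at x) (x /\<^sub>R norm x))"
    "\<And>j. (angular_deriv j f has_derivative
       (\<lambda>h. frechet_derivative (partial j f) (at x) h -
         ((x $ j / norm x) *\<^sub>R R h +
         (h $ j / norm x - x $ j * (x \<bullet> h) / norm x ^ 3) *\<^sub>R radial_deriv f x))) (at x)"
proof -
  let ?P = "\<lambda>j. frechet_derivative (partial j f) (at x)"
  let ?a = "\<lambda>j h. h $ j / norm x - x $ j * (x \<bullet> h) / norm x ^ 3"
  let ?R = "\<lambda>h. \<Sum>j\<in>UNIV. (x $ j / norm x) *\<^sub>R ?P j h + ?a j h *\<^sub>R partial j f x"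
  have P: "(partial j f has_derivative ?P j) (at x)" for j
    using C2_differentiable(2) frechet_derivative_works by blast
  have R: "(radial_deriv f has_derivative ?R) (at x)"
    unfolding radial_deriv_def[abs_def]
    by (intro has_derivative_sum has_derivative_scaleR has_derivative_direction assms P)
  moreover have "?R (x /\<^sub>R norm x) = (\<Sum>j\<in>UNIV. (x $ j / norm x) *\<^sub>R ?P j (x /\<^sub>R norm x))"
  proof -
    have "?a j (x /\<^sub>R norm x) = 0" for j
      using assms by (simp add: dot_square_norm field_simps power2_eq_square power3_eq_cube)
    then show ?thesis by simp
  qed
  moreover have "(angular_deriv j f has_derivative
      (\<lambda>h. ?P j h - ((x $ j / norm x) *\<^sub>R ?R h + ?a j h *\<^sub>R radial_deriv f x))) (at x)" for j
    unfolding angular_deriv_def[abs_def]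
    by (intro has_derivative_diff has_derivative_scaleR has_derivative_direction assms P R)
  ultimately show ?thesis by (rule that)
qed

lemma laplacian_split:
  assumes "x \<noteq> 0"
  shows "laplacian f x = radial_laplacian f x + spherical_laplacian f x"
proof -
  let ?P = "\<lambda>j. frechet_derivative (partial j f) (at x)"
  let ?e = "x /\<^sub>R norm x"
  let ?v = "\<lambda>j. axis j 1 - (x $ j / norm x) *\<^sub>R ?e"
  let ?a = "\<lambda>j h. h $ j / norm x - x $ j * (x \<bullet> h) / norm x ^ 3"
  obtain R where R: "(radial_deriv f has_derivative R) (at x)"
    "R ?e = (\<Sum>j\<in>UNIV. (x $ j / norm x) *\<^sub>R ?P j ?e)"
    and A: "\<And>j. (angular_deriv j f has_derivative
       (\<lambda>h. ?P j h - ((x $ j / norm x) *\<^sub>R R h + ?a j h *\<^sub>R radial_deriv f x))) (at x)"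
    by (rule angular_differentiable[OF assms], rule that)
  interpret R: linear R using R(1) has_derivative_linear by blast
  have P: "(partial j f has_derivative ?P j) (at x)" for j
    using C2_differentiable(2) frechet_derivative_works by blast
  have Plin: "linear (?P j)" for j using P has_derivative_linear by blast
  have Pv: "?P j (?v j) = ?P j (axis j 1) - (x $ j / norm x) *\<^sub>R ?P j ?e" for j
    using linear_diff[OF Plin] linear_scale[OF Plin] by metis
  have av: "?a j (?v j) = 1 / norm x - (x $ j)\<^sup>2 / norm x ^ 3" for j
  proof -
    have "x \<bullet> ?v j = 0"
      using assms by (simp add: inner_diff_right inner_axis dot_square_norm power2_eq_square)
    then show ?thesis
      using assms by (simp add: axis_def field_simps power2_eq_square power3_eq_cube)
  qed
  have Rv: "(\<Sum>j\<in>UNIV. (x $ j / norm x) *\<^sub>R R (?v j)) = 0"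
  proof -
    have "(\<Sum>j\<in>UNIV. (x $ j / norm x) *\<^sub>R R (?v j)) = R (\<Sum>j\<in>UNIV. (x $ j / norm x) *\<^sub>R ?v j)"
      by (simp only: R.sum R.scale)
    then show ?thesis by (simp only: angular_vectors[OF assms] R.zero)
  qed
  have sq: "(\<Sum>j\<in>UNIV. (x $ j)\<^sup>2) = (norm x)\<^sup>2"
    unfolding dot_square_norm[symmetric] inner_vec_def by (simp add: power2_eq_square)
  have sa: "(\<Sum>j\<in>UNIV. ?a j (?v j)) = (real CARD('n) - 1) / norm x"
    unfolding av sum_subtractf sum_divide_distrib[symmetric] sq using assms
    by (simp add: field_simps power2_eq_square power3_eq_cube)
  define b where "b = (\<lambda>j. ?a j (?v j))"
  have sb: "sum b UNIV = (real CARD('n) - 1) / norm x"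
    unfolding b_def by (rule sa)
  have "spherical_laplacian f x = (\<Sum>j\<in>UNIV. ?P j (axis j 1) - (x $ j / norm x) *\<^sub>R ?P j ?e -
      ((x $ j / norm x) *\<^sub>R R (?v j) + b j *\<^sub>R radial_deriv f x))"
    unfolding spherical_laplacian_def angular_deriv_eq[OF A] Pv b_def ..
  also have "\<dots> = laplacian f x - R ?e - ((real CARD('n) - 1) / norm x) *\<^sub>R radial_deriv f x"
    unfolding laplacian_def partial_eq[OF P] R(2) sum_subtractf sum.distrib Rv
      scaleR_sum_left[symmetric] sb by (simp only: add_0)
  finally show ?thesis
    by (simp add: radial_laplacian_def radial_deriv_eq[OF R(1)])
qed

lemma spherical_laplacian_eq_beltrami:
  assumes "x \<noteq> 0"
  shows "spherical_laplacian f x =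
    (1 / (norm x)\<^sup>2) *\<^sub>R sphere_laplace_beltrami (\<lambda>w. f (norm x *\<^sub>R w)) (x /\<^sub>R norm x)"
proof -
  define r where "r = norm x"
  have r: "r > 0" using assms by (simp add: r_def)
  define w where "w = x /\<^sub>R r"
  have w: "norm w = 1" "w \<noteq> 0" "r *\<^sub>R w = x" using r assms by (auto simp: w_def r_def)
  define h where "h = (\<lambda>y. f (r *\<^sub>R (y /\<^sub>R norm y)))"
  define phi where "phi = (\<lambda>y :: real^'n. r *\<^sub>R (y /\<^sub>R norm y))"
  have inv: "((\<lambda>y. inverse (norm y)) has_derivative (\<lambda>k. - ((y \<bullet> k) / norm y ^ 3))) (at y)"
    if "y \<noteq> 0" for y :: "real^'n"
    by (rule has_derivative_eq_rhs[OF Deriv.has_derivative_inverse[OF _ has_derivative_norm[OF that]]])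
      (use that in \<open>auto simp: fun_eq_iff sgn_div_norm inner_commute field_simps power3_eq_cube\<close>)
  have phi': "(phi has_derivative
      (\<lambda>k. (r / norm y) *\<^sub>R (k - ((y \<bullet> k) / (norm y)\<^sup>2) *\<^sub>R y))) (at y)"
    if "y \<noteq> 0" for y
    unfolding phi_def
    by (rule has_derivative_eq_rhs[OF has_derivative_scaleR_right[OF
          has_derivative_scaleR[OF inv[OF that] has_derivative_ident]]])
      (use that in \<open>auto simp: fun_eq_iff vec_eq_iff field_simps power2_eq_square power3_eq_cube\<close>)
  have f': "(f has_derivative frechet_derivative f (at y)) (at y)" for y
    using C2_differentiable(1) frechet_derivative_works by blast
  have flin: "linear (frechet_derivative f (at y))" for y
    using f' has_derivative_linear by blast
  have h1: "partial j h y = (r / norm y) *\<^sub>R angular_deriv j f (phi y)" if "y \<noteq> 0" for j y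
  proof -
    have dir: "phi y /\<^sub>R norm (phi y) = y /\<^sub>R norm y"
      using r that by (simp add: phi_def field_simps)
    have dirj: "phi y $ j / norm (phi y) = y $ j / norm y"
      using r that by (simp add: phi_def divide_inverse)
    have H: "(h has_derivative (\<lambda>k. frechet_derivative f (at (phi y))
        ((r / norm y) *\<^sub>R (k - ((y \<bullet> k) / (norm y)\<^sup>2) *\<^sub>R y)))) (at y)"
      using has_derivative_compose[OF phi'[OF that] f'] by (simp add: h_def phi_def)
    have eq: "((y \<bullet> axis j 1) / (norm y)\<^sup>2) *\<^sub>R y = (y $ j / norm y) *\<^sub>R (y /\<^sub>R norm y)"
      by (simp add: inner_axis power2_eq_square divide_inverse)
    show ?thesis
      unfolding partial_eq[OF H] angular_deriv_eq[OF f'] dir dirj eq linear_scale[OF flin] ..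
  qed
  obtain R where A: "\<And>j. (angular_deriv j f has_derivative
       (\<lambda>h. frechet_derivative (partial j f) (at x) h -
         ((x $ j / norm x) *\<^sub>R R h +
         (h $ j / norm x - x $ j * (x \<bullet> h) / norm x ^ 3) *\<^sub>R radial_deriv f x))) (at x)"
    by (rule angular_differentiable[OF assms], rule that)
  define M where "M = (\<lambda>j h. frechet_derivative (partial j f) (at x) h -
         ((x $ j / norm x) *\<^sub>R R h +
         (h $ j / norm x - x $ j * (x \<bullet> h) / norm x ^ 3) *\<^sub>R radial_deriv f x))"
  have M: "(angular_deriv j f has_derivative M j) (at x)" for j
    using A by (simp add: M_def)
  have Mlin: "linear (M j)" for j using M has_derivative_linear by blast
  have phiw: "phi w = x" using w by (simp add: phi_def)
  have ev: "x $ j / norm x = w $ j" "x /\<^sub>R norm x = w" for j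
    by (simp_all add: w_def r_def divide_inverse mult.commute)
  let ?v = "\<lambda>j. axis j 1 - (w $ j) *\<^sub>R w"
  have h2: "partial j (partial j h) w =
      r\<^sup>2 *\<^sub>R angular_deriv j (angular_deriv j f) x - r *\<^sub>R (w $ j *\<^sub>R angular_deriv j f x)" for j
  proof -
    have M': "(angular_deriv j f has_derivative M j) (at (phi w))"
      using M phiw by simp
    have "((\<lambda>y. (r * inverse (norm y)) *\<^sub>R angular_deriv j f (phi y)) has_derivative
        (\<lambda>k. (r * inverse (norm w)) *\<^sub>R
            M j ((r / norm w) *\<^sub>R (k - ((w \<bullet> k) / (norm w)\<^sup>2) *\<^sub>R w))
          + (r * - ((w \<bullet> k) / norm w ^ 3)) *\<^sub>R angular_deriv j f (phi w))) (at w)"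
      by (intro has_derivative_scaleR has_derivative_mult_right inv w
          has_derivative_compose[OF phi' M'])
    then have "(partial j h has_derivative
        (\<lambda>k. (r * inverse (norm w)) *\<^sub>R
            M j ((r / norm w) *\<^sub>R (k - ((w \<bullet> k) / (norm w)\<^sup>2) *\<^sub>R w))
          + (r * - ((w \<bullet> k) / norm w ^ 3)) *\<^sub>R angular_deriv j f (phi w))) (at w)"
      by (rule has_derivative_transform_within_open[where s = "- {0}"])
        (use w h1 in \<open>auto simp: divide_inverse\<close>)
    from partial_eq[OF this, of j] show ?thesis
      unfolding angular_deriv_eq[OF M] ev phiw
      by (simp add: w(1) inner_axis linear_scale[OF Mlin] power2_eq_square)
  qed
  have orth: "(\<Sum>j\<in>UNIV. w $ j *\<^sub>R angular_deriv j f x) = 0"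
  proof -
    have "(\<Sum>j\<in>UNIV. w $ j *\<^sub>R angular_deriv j f x) =
        frechet_derivative f (at x) (\<Sum>j\<in>UNIV. w $ j *\<^sub>R ?v j)"
      unfolding angular_deriv_eq[OF f'] ev
      by (simp only: linear_sum[OF flin] linear_scale[OF flin])
    also have "(\<Sum>j\<in>UNIV. w $ j *\<^sub>R ?v j) = 0"
      using angular_vectors[OF assms] unfolding ev .
    finally show ?thesis by (simp only: linear_0[OF flin])
  qed
  have "laplacian h w = r\<^sup>2 *\<^sub>R spherical_laplacian f x"
    unfolding laplacian_def h2 sum_subtractf scaleR_sum_right[symmetric] orth
    by (simp add: spherical_laplacian_def)
  then show ?thesis
    using r unfolding sphere_laplace_beltrami_def h_def w_def r_def by simp
qed

end

end

theory Submission
  imports Defs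
begin

text \<open>Since $\sum_j x_j L_j = 0$, integration by parts gives
  $\langle u, \Delta_s f\rangle = -\sum_j \langle L_j u, L_j f\rangle$. From
  $L_j\partial_r = \partial_r L_j + |x|^{-1} L_j$ one gets, with $w = L_j f$,
  $L_j\Delta_r f = \partial_r^2 w + \frac{n+1}{|x|}\partial_r w + \frac{n-1}{|x|^2} w$,
  and a radial integration by parts shows
  $-\mathrm{Re}\,\langle L_j\Delta_r f, L_j f\rangle
    = \|\partial_r w + |x|^{-1} w\|_2^2 + (n-4)\,\||x|^{-1} w\|_2^2 \ge 0$.
  In Cartesian coordinates, both integrations by parts reduce to $\int \partial_j u = 0$.\<close>

section \<open>Stability of test functions\<close>

text \<open>The bound n \<ge> 4 is that of Hardy's inequality. If the cross term Re((dr w) cnj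
  w)/|x|, with dr the radial derivative, is traded entirely for |w|^2/|x|^2, the radial form becomes
  ||dr w||^2 - || |x|^{-1} w ||^2. Hardy's constant (n-2)^2/4 reaches 1 at n = 4. Completing the
  square with dr w + w/|x| is Hardy's argument with coefficient 1, which is the optimal coefficient
  (n-2)/2 when n = 4. The obstacle is that smoothness and partial derivatives refer to the whole
  space, while 1/|x| and x_j/|x| are singular at the origin. Hence these coefficients are handled in
  products with a test function. Such products are again test functions, so they are integrable and
  can be differentiated repeatedly. The pointwise identities then hold at the origin as well, where
  both sides vanish, and the integrals need no cutoff there.\<close>

lemma differentiable_has_partials:
  assumes "u differentiable (at x)"
  shows "(u has_derivative frechet_derivative u (at x)) (at x)"
  using assms frechet_derivative_works by blast

lemma partial_add:
  assumes "u differentiable (at x)" "v differentiable (at x)"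
  shows "partial j (\<lambda>x. u x + v x) x = partial j u x + partial j v x"
  using partial_eq[OF has_derivative_add[OF assms[THEN differentiable_has_partials]]]
  by (simp add: partial_def)

lemma partial_mult:
  assumes "u differentiable (at x)" "v differentiable (at x)"
  shows "partial j (\<lambda>x. u x * v x) x = partial j u x * v x + u x * partial j v x"
  using partial_eq[OF has_derivative_mult[OF assms[THEN differentiable_has_partials]]]
  by (simp add: partial_def)

lemma partial_cnj:
  assumes "u differentiable (at x)"
  shows "partial j (\<lambda>x. cnj (u x)) x = cnj (partial j u x)"
  using partial_eq[OF has_derivative_cnj[OF differentiable_has_partials[OF assms]]]
  by (simp add: partial_def)

lemma partial_of_real:
  assumes "(c has_derivative D) (at x)"
  shows "partial j (\<lambda>x. complex_of_real (c x)) x = of_real (D (axis j 1))"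
  using partial_eq[OF has_derivative_of_real[OF assms]] .

lemma partial_const: "partial j (\<lambda>_. c) = (\<lambda>_. 0)"
  using partial_eq[OF has_derivative_const] by fastforce

text \<open>\<open>frechet_derivative\<close> is a choice among all derivatives at the point, and
  the chosen predicate depends only on the values near that point. Both choices are therefore made
  from the same predicate.\<close>

lemma partial_cong_open:
  assumes "open S" "x \<in> S" "\<And>y. y \<in> S \<Longrightarrow> u y = v y"
  shows "partial j u x = partial j v x"
  unfolding partial_def frechet_derivative_def
  using has_derivative_transform_within_open[OF _ assms(1,2)] assms(3) by metis

lemma Ck_continuous: "Ck k u \<Longrightarrow> continuous_on UNIV u"
  by (cases k) (auto intro: continuous_at_imp_continuous_on differentiable_imp_continuous_within)

lemma Ck_SucD: "Ck (Suc k) u \<Longrightarrow> Ck k u"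
  by (induction k arbitrary: u)
    (auto intro: continuous_at_imp_continuous_on differentiable_imp_continuous_within)

lemma Ck_add: "Ck k u \<Longrightarrow> Ck k v \<Longrightarrow> Ck k (\<lambda>x. u x + v x)"
proof (induction k arbitrary: u v)
  case (Suc k)
  then have "partial j (\<lambda>x. u x + v x) = (\<lambda>x. partial j u x + partial j v x)" for j
    by (auto simp: fun_eq_iff intro!: partial_add)
  with Suc show ?case by auto
qed (auto intro: continuous_intros)

lemma Ck_mult: "Ck k u \<Longrightarrow> Ck k v \<Longrightarrow> Ck k (\<lambda>x. u x * v x)"
proof (induction k arbitrary: u v)
  case (Suc k)
  then have "partial j (\<lambda>x. u x * v x) = (\<lambda>x. partial j u x * v x + u x * partial j v x)" for j
    by (auto simp: fun_eq_iff intro!: partial_mult)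
  \<comment> \<open>Each term of the product rule keeps one factor undifferentiated, so the
    induction hypothesis needs that factor at the lower order.\<close>
  moreover have "Ck k u" "Ck k v" using Suc.prems Ck_SucD by blast+
  ultimately show ?case using Suc by (auto intro!: Ck_add)
qed (auto intro: continuous_intros)

lemma Ck_cnj: "Ck k u \<Longrightarrow> Ck k (\<lambda>x. cnj (u x))"
proof (induction k arbitrary: u)
  case (Suc k)
  then have "partial j (\<lambda>x. cnj (u x)) = (\<lambda>x. cnj (partial j u x))" for j
    by (auto simp: fun_eq_iff intro!: partial_cnj)
  moreover have "(\<lambda>x. cnj (u x)) differentiable (at x)" for x
    using Suc.prems has_derivative_cnj by (fastforce simp: differentiable_def)
  ultimately show ?case using Suc by auto
qed (auto intro: continuous_intros)

lemma smooth_const: "smooth (\<lambda>_ :: real^'n::finite. c)"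
proof -
  have "Ck k (\<lambda>_ :: real^'n. c)" for k
    by (induction k arbitrary: c) (auto simp: partial_const)
  then show ?thesis by (simp add: smooth_def)
qed

lemma smooth_coord: "smooth (\<lambda>x :: real^'n::finite. complex_of_real (x $ i))"
proof -
  have d: "((\<lambda>x. x $ i) has_derivative (\<lambda>h. h $ i)) (at x)" for x :: "real^'n"
    by (rule bounded_linear_imp_has_derivative[OF bounded_linear_vec_nth])
  have p: "partial j (\<lambda>x :: real^'n. complex_of_real (x $ i)) = (\<lambda>_. of_real (axis j 1 $ i))" for j
    using partial_of_real[OF d] by fastforce
  have "Ck k (\<lambda>x :: real^'n. complex_of_real (x $ i))" for k
  proof (cases k)
    case (Suc m)
    have "(\<lambda>x :: real^'n. complex_of_real (x $ i)) differentiable (at x)" for x :: "real^'n"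
      using has_derivative_of_real[OF d] by (fastforce simp: differentiable_def)
    then show ?thesis
      using Suc p by (simp add: smooth_const[unfolded smooth_def])
  qed (auto intro!: continuous_intros)
  then show ?thesis by (simp add: smooth_def)
qed

text \<open>Any compact set off the origin may witness the support. Sums then use a union of
  witnesses, and products and derivatives reuse a given one, without computing closures.\<close>

lemma test_functions_iff:
  "u \<in> test_functions \<longleftrightarrow> smooth u \<and> (\<exists>K. compact K \<and> 0 \<notin> K \<and> (\<forall>x. x \<notin> K \<longrightarrow> u x = 0))"
proof safe
  assume u: "u \<in> test_functions"
  then show "smooth u" by (simp add: test_functions_def)
  show "\<exists>K. compact K \<and> 0 \<notin> K \<and> (\<forall>x. x \<notin> K \<longrightarrow> u x = 0)"
    using u closure_subset[of "{x. u x \<noteq> 0}"]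
    by (intro exI[of _ "closure {x. u x \<noteq> 0}"]) (auto simp: test_functions_def)
next
  fix K assume "smooth u" and K: "compact K" "0 \<notin> K" "\<forall>x. x \<notin> K \<longrightarrow> u x = 0"
  have "closure {x. u x \<noteq> 0} \<subseteq> K"
    using K by (intro closure_minimal) (auto intro: compact_imp_closed)
  with K \<open>smooth u\<close> show "u \<in> test_functions"
    using compact_Int_closed[OF K(1) closed_closure, of "{x. u x \<noteq> 0}"]
    by (auto simp: test_functions_def Int_absorb1)
qed

lemma test_support:
  assumes "u \<in> test_functions"
  obtains K where "compact K" "0 \<notin> K" "\<And>x. x \<notin> K \<Longrightarrow> u x = 0"
  using assms unfolding test_functions_iff by auto

lemma test_Ck: "u \<in> test_functions \<Longrightarrow> Ck k u"
  by (simp add: test_functions_iff smooth_def)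

lemma test_differentiable [simp]: "u \<in> test_functions \<Longrightarrow> u differentiable (at x)"
  using test_Ck[of u "Suc 0"] by auto

lemma test_continuous: "u \<in> test_functions \<Longrightarrow> continuous_on UNIV u"
  using test_Ck Ck_continuous by blast

lemma test_zero: "u \<in> test_functions \<Longrightarrow> u 0 = 0"
  by (metis test_support)

lemma test_add:
  assumes "u \<in> test_functions" "v \<in> test_functions"
  shows "(\<lambda>x. u x + v x) \<in> test_functions"
proof -
  obtain K where K: "compact K" "0 \<notin> K" "\<And>x. x \<notin> K \<Longrightarrow> u x = 0"
    using assms(1) test_support by metis
  obtain L where L: "compact L" "0 \<notin> L" "\<And>x. x \<notin> L \<Longrightarrow> v x = 0"
    using assms(2) test_support by metis
  have "\<exists>K. compact K \<and> 0 \<notin> K \<and> (\<forall>x. x \<notin> K \<longrightarrow> u x + v x = 0)"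
    using K L by (intro exI[of _ "K \<union> L"]) auto
  moreover have "smooth (\<lambda>x. u x + v x)"
    unfolding smooth_def using assms by (intro allI Ck_add test_Ck)
  ultimately show ?thesis by (simp add: test_functions_iff)
qed

lemma test_smooth_mult:
  assumes "smooth v" "u \<in> test_functions"
  shows "(\<lambda>x. v x * u x) \<in> test_functions"
proof -
  obtain K where "compact K" "0 \<notin> K" "\<And>x. x \<notin> K \<Longrightarrow> u x = 0"
    using assms test_support by metis
  then show ?thesis
    using assms unfolding test_functions_iff smooth_def
    by (auto intro!: Ck_mult exI[of _ K])
qed

lemma test_mult:
  "u \<in> test_functions \<Longrightarrow> v \<in> test_functions \<Longrightarrow> (\<lambda>x. u x * v x) \<in> test_functions"
  using test_smooth_mult test_functions_iff by blast

lemma test_cmult: "u \<in> test_functions \<Longrightarrow> (\<lambda>x. c * u x) \<in> test_functions"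
  using test_smooth_mult[OF smooth_const] .

lemma test_cnj:
  assumes "u \<in> test_functions"
  shows "(\<lambda>x. cnj (u x)) \<in> test_functions"
proof -
  obtain K where "compact K" "0 \<notin> K" "\<And>x. x \<notin> K \<Longrightarrow> u x = 0"
    using assms test_support by metis
  then show ?thesis
    using assms unfolding test_functions_iff smooth_def
    by (auto intro!: Ck_cnj exI[of _ K])
qed

lemma test_uminus: "u \<in> test_functions \<Longrightarrow> (\<lambda>x. - u x) \<in> test_functions"
  using test_cmult[of u "-1"] by simp

lemma test_diff:
  "u \<in> test_functions \<Longrightarrow> v \<in> test_functions \<Longrightarrow> (\<lambda>x. u x - v x) \<in> test_functions"
  using test_add[OF _ test_uminus, of u v] by simp

lemma test_sum:
  "(\<And>i. i \<in> I \<Longrightarrow> u i \<in> test_functions) \<Longrightarrow> (\<lambda>x. \<Sum>i\<in>I. u i x) \<in> test_functions"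
proof (induction I rule: infinite_finite_induct)
  case (insert i I)
  then show ?case by (auto intro!: test_add)
\<comment> \<open>Over an empty or infinite index set the sum is the zero function, supported in the
  empty set.\<close>
qed (auto simp: test_functions_iff smooth_const intro: exI[of _ "{}"])

lemma partial_eq_0_off_support:
  assumes "closed K" "\<And>x. x \<notin> K \<Longrightarrow> u x = 0" "x \<notin> K"
  shows "partial j u x = 0"
  using partial_cong_open[of "- K" x u "\<lambda>_. 0" j] assms by (auto simp: partial_const)

lemma test_partial:
  assumes "u \<in> test_functions"
  shows "partial j u \<in> test_functions"
proof -
  obtain K where K: "compact K" "0 \<notin> K" "\<And>x. x \<notin> K \<Longrightarrow> u x = 0"
    using assms test_support by metis
  have "Ck k (partial j u)" for k
    using test_Ck[OF assms, of "Suc k"] by simp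
  then show ?thesis
    unfolding test_functions_iff smooth_def using K
    by (auto intro!: exI[of _ K] partial_eq_0_off_support compact_imp_closed)
qed

section \<open>Multiplication by powers of 1/|x|\<close>

lemma has_derivative_inverse_norm_power:
  assumes "x \<noteq> (0 :: real^'n::finite)"
  shows "((\<lambda>x. inverse (norm x) ^ m) has_derivative
    (\<lambda>h. - real m * (x \<bullet> h) * inverse (norm x) ^ (m + 2))) (at x)"
proof -
  have "((\<lambda>y. inverse (norm y)) has_derivative (\<lambda>k. - ((x \<bullet> k) / norm x ^ 3))) (at x)"
    by (rule has_derivative_eq_rhs[OF Deriv.has_derivative_inverse[OF _ has_derivative_norm[OF assms]]])
      (use assms in \<open>auto simp: fun_eq_iff sgn_div_norm inner_commute field_simps power3_eq_cube\<close>)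
  from has_derivative_power[OF this, of m] show ?thesis
    by (rule has_derivative_eq_rhs) (cases m;
        use assms in \<open>auto simp: fun_eq_iff field_simps power3_eq_cube power2_eq_square\<close>)
qed

text \<open>Both terms of the derivative again have the shape "power of 1/|x| times a test
  function": the coordinate x_j is absorbed into the test function and the exponent rises by 2. This
  closed form lets the order of differentiability be raised by induction, with exponent and function
  generalized.\<close>

lemma test_inverse_norm_power_has_derivative:
  assumes u: "u \<in> test_functions"
  shows "(\<lambda>x. of_real (inverse (norm x) ^ m) * u x) differentiable (at x)"
    and "partial j (\<lambda>x. of_real (inverse (norm x) ^ m) * u x) x =
      of_real (inverse (norm x) ^ m) * partial j u x
      + of_real (inverse (norm x) ^ (m + 2)) * (- of_nat m * (of_real (x $ j) * u x))"
proof -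
  let ?w = "\<lambda>x. of_real (inverse (norm x) ^ m) * u x"
  have "?w differentiable (at x) \<and> partial j ?w x =
      of_real (inverse (norm x) ^ m) * partial j u x
      + of_real (inverse (norm x) ^ (m + 2)) * (- of_nat m * (of_real (x $ j) * u x))"
  proof (cases "x = 0")
    case True
    obtain K where K: "compact K" "0 \<notin> K" "\<And>x. x \<notin> K \<Longrightarrow> u x = 0"
      using assms test_support by metis
    then have K': "closed K" by (simp add: compact_imp_closed)
    \<comment> \<open>The origin lies in the open complement of \<open>K\<close>, on which the
      product vanishes whatever value the coefficient takes.\<close>
    have "(?w has_derivative (\<lambda>_. 0)) (at x)"
      by (rule has_derivative_transform_within_open[OF has_derivative_const, of "- K"])
        (use True K K' in auto)
    then have "?w differentiable (at x)" by (auto simp: differentiable_def)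
    moreover have "partial j ?w x = 0"
      using K K' True by (intro partial_eq_0_off_support[of K]) auto
    ultimately show ?thesis
      using True test_zero[OF u] test_zero[OF test_partial[OF u]] by auto
  next
    case False
    note d = has_derivative_of_real[OF has_derivative_inverse_norm_power[OF False],
        where 'a=complex, of m]
    have "(\<lambda>x. complex_of_real (inverse (norm x) ^ m)) differentiable (at x)"
      using d by (auto simp: differentiable_def)
    then show ?thesis
      using u partial_of_real[OF has_derivative_inverse_norm_power[OF False], of j m]
      by (auto simp: partial_mult inner_axis algebra_simps simp del: of_real_power)
  qed
  then show "?w differentiable (at x)" "partial j ?w x =
      of_real (inverse (norm x) ^ m) * partial j u x
      + of_real (inverse (norm x) ^ (m + 2)) * (- of_nat m * (of_real (x $ j) * u x))"
    by auto
qed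

lemma test_inverse_norm_power:
  assumes "u \<in> test_functions"
  shows "(\<lambda>x. of_real (inverse (norm x) ^ m) * u x) \<in> test_functions"
proof -
  obtain K where K: "compact K" "0 \<notin> K" "\<And>x. x \<notin> K \<Longrightarrow> u x = 0"
    using assms test_support by metis
  have "Ck k (\<lambda>x. of_real (inverse (norm x) ^ m) * u x)" for k
    using assms
  proof (induction k arbitrary: u m)
    case 0
    then show ?case
      using test_inverse_norm_power_has_derivative(1)[OF 0]
      by (auto intro!: continuous_at_imp_continuous_on differentiable_imp_continuous_within
          simp del: of_real_power)
  next
    case (Suc k)
    have "partial j (\<lambda>x. of_real (inverse (norm x) ^ m) * u x) =
        (\<lambda>x. of_real (inverse (norm x) ^ m) * partial j u x
        + of_real (inverse (norm x) ^ (m + 2)) * (- of_nat m * (of_real (x $ j) * u x)))" for j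
      by (rule ext) (rule test_inverse_norm_power_has_derivative[OF Suc.prems])
    moreover have "Ck k (\<lambda>x. of_real (inverse (norm x) ^ m) * partial j u x
        + of_real (inverse (norm x) ^ (m + 2)) * (- of_nat m * (of_real (x $ j) * u x)))" for j
      by (intro Ck_add Suc.IH test_partial test_cmult test_smooth_mult[OF smooth_coord] Suc.prems)
    ultimately show ?case
      using test_inverse_norm_power_has_derivative(1)[OF Suc.prems] by (simp only: Ck.simps) simp
  qed
  with K show ?thesis
    unfolding test_functions_iff smooth_def by (auto intro!: exI[of _ K] simp del: of_real_power)
qed

section \<open>Symmetry of second derivatives\<close>

lemma has_vector_derivative_axis_line:
  assumes "\<And>x. v differentiable (at x)"
  shows "((\<lambda>t. v (y + t *\<^sub>R axis j 1)) has_vector_derivative partial j v (y + t *\<^sub>R axis j 1))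
    (at t within S)"
proof -
  let ?D = "frechet_derivative v (at (y + t *\<^sub>R axis j 1))"
  have D: "(v has_derivative ?D) (at (y + t *\<^sub>R axis j 1))"
    using assms by (rule differentiable_has_partials)
  have "((\<lambda>t. y + t *\<^sub>R axis j 1) has_derivative (\<lambda>h. h *\<^sub>R axis j 1)) (at t within S)"
    by (auto intro!: derivative_eq_intros)
  from has_derivative_compose[OF this D]
  show ?thesis
    by (simp add: has_vector_derivative_def partial_def linear_scale[OF has_derivative_linear[OF D]])
qed

text \<open>The mean value inequality for v(y + t e_j) - t c on [0,h]. Nested twice it controls
  second differences; with c = 0 it gives the Lipschitz bound used for dominated
  convergence.\<close>

lemma axis_increment_bound:
  assumes "\<And>x. v differentiable (at x)" "0 \<le> h"
    and "\<And>t. 0 \<le> t \<Longrightarrow> t \<le> h \<Longrightarrow> norm (partial j v (y + t *\<^sub>R axis j 1) - c) \<le> B"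
  shows "norm (v (y + h *\<^sub>R axis j 1) - v y - h *\<^sub>R c) \<le> h * B"
proof -
  have "norm ((v (y + h *\<^sub>R axis j 1) - h *\<^sub>R c) - (v (y + 0 *\<^sub>R axis j 1) - 0 *\<^sub>R c)) \<le> B * norm (h - 0)"
  proof (rule differentiable_bound[of "{0..h}"])
    fix t assume t: "t \<in> {0..h}"
    have "((\<lambda>t. v (y + t *\<^sub>R axis j 1) - t *\<^sub>R c) has_vector_derivative
        partial j v (y + t *\<^sub>R axis j 1) - 1 *\<^sub>R c) (at t within {0..h})"
      by (intro has_vector_derivative_diff has_vector_derivative_axis_line assms)
        (auto intro!: derivative_eq_intros simp: has_vector_derivative_def)
    then show "((\<lambda>t. v (y + t *\<^sub>R axis j 1) - t *\<^sub>R c) has_derivative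
        (\<lambda>k. k *\<^sub>R (partial j v (y + t *\<^sub>R axis j 1) - c))) (at t within {0..h})"
      by (simp add: has_vector_derivative_def)
    have "0 \<le> B" using order_trans[OF norm_ge_zero assms(3)[of 0]] assms(2) by simp
    then show "onorm (\<lambda>k. k *\<^sub>R (partial j v (y + t *\<^sub>R axis j 1) - c)) \<le> B"
      using assms(3)[of t] t by (intro onorm_le) (auto simp: mult.commute[of B] intro!: mult_left_mono)
  qed (use assms in auto)
  then show ?thesis using assms(2) by (simp add: algebra_simps)
qed

text \<open>The second difference is the increment along e_j of the increment of \<open>u\<close>
  along e_i. The outer application of \<open>axis_increment_bound\<close> leads to an increment of
  \<open>partial j u\<close> along e_i, to which the inner one applies.\<close>

lemma second_difference_bound:
  assumes u: "Ck 2 u" and h: "0 \<le> h"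
    and B: "\<And>s t. 0 \<le> s \<Longrightarrow> s \<le> h \<Longrightarrow> 0 \<le> t \<Longrightarrow> t \<le> h \<Longrightarrow>
      norm (partial i (partial j u) (x + s *\<^sub>R axis i 1 + t *\<^sub>R axis j 1) - c) \<le> B"
  shows "norm (u (x + h *\<^sub>R axis i 1 + h *\<^sub>R axis j 1) - u (x + h *\<^sub>R axis i 1)
    - u (x + h *\<^sub>R axis j 1) + u x - (h * h) *\<^sub>R c) \<le> h * (h * B)"
proof -
  have ud: "u differentiable (at y)" "partial j u differentiable (at y)" for y
    using u by (auto simp: numeral_2_eq_2)
  let ?p = "\<lambda>y. y + h *\<^sub>R axis i 1"
  let ?v = "\<lambda>y. u (?p y) - u y"
  have v: "(?v has_derivative (\<lambda>k. frechet_derivative u (at (?p y)) k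
      - frechet_derivative u (at y) k)) (at y)" for y
  proof -
    have "(?p has_derivative (\<lambda>k. k)) (at y)" by (auto intro!: derivative_eq_intros)
    from has_derivative_compose[OF this differentiable_has_partials[OF ud(1)]]
    show ?thesis by (intro has_derivative_diff differentiable_has_partials ud)
  qed
  have pv: "partial j ?v y = partial j u (?p y) - partial j u y" for y
    using partial_eq[OF v] by (simp add: partial_def)
  have "norm (?v (x + h *\<^sub>R axis j 1) - ?v x - h *\<^sub>R (h *\<^sub>R c)) \<le> h * (h * B)"
  proof (rule axis_increment_bound[OF _ h])
    show "?v differentiable (at y)" for y using v by (auto simp: differentiable_def)
    fix t assume t: "0 \<le> t" "t \<le> h"
    have "norm (partial j u (?p (x + t *\<^sub>R axis j 1)) - partial j u (x + t *\<^sub>R axis j 1) - h *\<^sub>R c) \<le> h * B"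
    proof (rule axis_increment_bound[OF ud(2) h])
      fix s assume "0 \<le> s" "s \<le> h"
      then show "norm (partial i (partial j u) (x + t *\<^sub>R axis j 1 + s *\<^sub>R axis i 1) - c) \<le> B"
        using B[of s t] t by (simp add: add.assoc add.commute[of "t *\<^sub>R _"])
    qed
    then show "norm (partial j ?v (x + t *\<^sub>R axis j 1) - h *\<^sub>R c) \<le> h * B"
      by (simp add: pv)
  qed
  then show ?thesis
    by (simp add: algebra_simps)
qed

lemma second_difference_tendsto:
  fixes u :: "real^'n::finite \<Rightarrow> complex"
  assumes u: "Ck 2 u"
  shows "((\<lambda>h. (u (x + h *\<^sub>R axis i 1 + h *\<^sub>R axis j 1) - u (x + h *\<^sub>R axis i 1)
    - u (x + h *\<^sub>R axis j 1) + u x) /\<^sub>R (h * h)) \<longlongrightarrow> partial i (partial j u) x) (at_right 0)"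
proof (rule tendstoI)
  fix e :: real assume e: "0 < e"
  let ?c = "partial i (partial j u) x"
  have "isCont (partial i (partial j u)) x"
    using u by (simp add: numeral_2_eq_2 continuous_on_eq_continuous_at)
  then obtain d where d: "d > 0" "\<And>y. dist y x < d \<Longrightarrow> dist (partial i (partial j u) y) ?c < e / 2"
    using e unfolding continuous_at_eps_delta by (metis half_gt_zero)
  \<comment> \<open>A point of the square of side h is at distance at most s + t \<le> 2h from x, so
    h < d/2 keeps the square inside the d-ball.\<close>
  have "eventually (\<lambda>h. h \<in> {0<..<d / 2}) (at_right 0)"
    using d by (intro eventually_at_right_real) auto
  then show "\<forall>\<^sub>F h in at_right 0. dist ((u (x + h *\<^sub>R axis i 1 + h *\<^sub>R axis j 1) - u (x + h *\<^sub>R axis i 1)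
    - u (x + h *\<^sub>R axis j 1) + u x) /\<^sub>R (h * h)) ?c < e"
  proof eventually_elim
    case (elim h)
    then have h: "0 < h" "h < d / 2" by auto
    let ?q = "u (x + h *\<^sub>R axis i 1 + h *\<^sub>R axis j 1) - u (x + h *\<^sub>R axis i 1)
      - u (x + h *\<^sub>R axis j 1) + u x"
    have "norm (?q - (h * h) *\<^sub>R ?c) \<le> h * (h * (e / 2))"
    proof (rule second_difference_bound[OF u])
      fix s t assume st: "0 \<le> s" "s \<le> h" "0 \<le> t" "t \<le> h"
      have "norm (s *\<^sub>R axis i 1 + t *\<^sub>R axis j 1 :: real^'n) \<le> s + t"
        using st by (intro order_trans[OF norm_triangle_ineq]) (simp add: norm_axis_1)
      then have "dist (x + s *\<^sub>R axis i 1 + t *\<^sub>R axis j 1) x < d"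
        using st h by (simp add: dist_norm add.assoc)
      from d(2)[OF this] show "norm (partial i (partial j u) (x + s *\<^sub>R axis i 1 + t *\<^sub>R axis j 1) - ?c) \<le> e / 2"
        by (simp add: dist_norm)
    qed (use h in simp)
    moreover have "?q /\<^sub>R (h * h) - ?c = (?q - (h * h) *\<^sub>R ?c) /\<^sub>R (h * h)"
    proof -
      have "inverse (h * h) * (h * h) = 1" using h by (simp add: field_simps)
      then show ?thesis by (simp only: scaleR_diff_right scaleR_scaleR scaleR_one)
    qed
    ultimately have "norm (?q /\<^sub>R (h * h) - ?c) \<le> e / 2"
      using h by (simp only: norm_scaleR) (simp add: field_simps)
    with e show ?case by (simp add: dist_norm)
  qed
qed

text \<open>The second difference quotient is symmetric in i and j, so exchanging them gives a
  second value for the same limit.\<close>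

lemma partial_commute:
  assumes "Ck 2 u"
  shows "partial i (partial j u) x = partial j (partial i u) x"
proof (rule tendsto_unique[OF _ second_difference_tendsto[OF assms]])
  show "((\<lambda>h. (u (x + h *\<^sub>R axis i 1 + h *\<^sub>R axis j 1) - u (x + h *\<^sub>R axis i 1)
    - u (x + h *\<^sub>R axis j 1) + u x) /\<^sub>R (h * h)) \<longlongrightarrow> partial j (partial i u) x) (at_right 0)"
    using second_difference_tendsto[OF assms, of x j i]
    by (simp add: algebra_simps)
qed simp

section \<open>Integrals of derivatives\<close>

lemma test_integrable:
  assumes "u \<in> test_functions"
  shows "integrable lborel u"
proof -
  obtain K where K: "compact K" "\<And>x. x \<notin> K \<Longrightarrow> u x = 0"
    using assms test_support by metis
  have "integrable lborel (\<lambda>x. indicator K x *\<^sub>R u x)"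
    using K assms by (intro borel_integrable_compact)
      (auto intro: continuous_on_subset[OF test_continuous])
  moreover have "indicator K x *\<^sub>R u x = u x" for x
    using K by (auto simp: indicator_def)
  ultimately show ?thesis by simp
qed

text \<open>Differentiate the constant $t \mapsto \int u(x + t e_j)\,dx$ under the integral sign.\<close>

lemma integral_partial_eq_0:
  fixes u :: "real^'n::finite \<Rightarrow> complex"
  assumes u: "u \<in> test_functions"
  shows "(\<integral>x. partial j u x \<partial>lborel) = 0"
proof -
  obtain K where K: "compact K" "\<And>x. x \<notin> K \<Longrightarrow> u x = 0"
    using assms test_support by metis
  obtain R where R: "\<And>x. x \<in> K \<Longrightarrow> norm x \<le> R"
    using K compact_imp_bounded bounded_iff by metis
  have cont: "continuous_on UNIV u" "continuous_on UNIV (partial j u)"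
    using u test_partial test_continuous by blast+
  then have meas[measurable]: "u \<in> borel_measurable borel" "partial j u \<in> borel_measurable borel"
    using borel_measurable_continuous_onI by blast+
  have "compact (partial j u ` K)"
    using cont K by (auto intro: compact_continuous_image continuous_on_subset)
  then obtain B where B: "\<And>x. x \<in> K \<Longrightarrow> norm (partial j u x) \<le> B" "B > 0"
    using compact_imp_bounded bounded_pos by (metis imageI)
  have B': "norm (partial j u x) \<le> B" for x
    using B partial_eq_0_off_support[of K u x j] K compact_imp_closed[OF K(1)] by (cases "x \<in> K") auto
  let ?h = "\<lambda>n. inverse (real (Suc n))"
  let ?e = "axis j 1 :: real^'n"
  let ?s = "\<lambda>n x. (u (x + ?h n *\<^sub>R ?e) - u x) /\<^sub>R ?h n"
  have "(\<lambda>n. \<integral>x. ?s n x \<partial>lborel) \<longlonglongrightarrow> (\<integral>x. partial j u x \<partial>lborel)"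
  \<comment> \<open>The shifts have length at most 1 and the support lies in the ball of radius R.
    All difference quotients therefore vanish outside radius R + 1, and inside they are bounded by
    \<open>B\<close>.\<close>
  proof (rule integral_dominated_convergence[where w="\<lambda>x. indicator (cball 0 (R + 1)) x *\<^sub>R B"])
    show "integrable lborel (\<lambda>x. indicator (cball (0::real^'n) (R + 1)) x *\<^sub>R B)"
      by (intro borel_integrable_compact) auto
    show "AE x in lborel. (\<lambda>n. ?s n x) \<longlonglongrightarrow> partial j u x"
    proof (rule AE_I2)
      fix x
      have "((\<lambda>t. u (x + t *\<^sub>R ?e)) has_vector_derivative partial j u (x + 0 *\<^sub>R ?e)) (at 0)"
        using u by (intro has_vector_derivative_axis_line) auto
      then have "(\<lambda>t. norm (u (x + t *\<^sub>R ?e) - u x - t *\<^sub>R partial j u x) / norm t) \<midarrow>0\<rightarrow> 0"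
        by (simp add: has_vector_derivative_def has_derivative_at)
      then have "(\<lambda>t. norm ((u (x + t *\<^sub>R ?e) - u x) /\<^sub>R t - partial j u x)) \<midarrow>0\<rightarrow> 0"
      proof (rule Lim_transform_eventually)
        show "\<forall>\<^sub>F t in at 0. norm (u (x + t *\<^sub>R ?e) - u x - t *\<^sub>R partial j u x) / norm t =
            norm ((u (x + t *\<^sub>R ?e) - u x) /\<^sub>R t - partial j u x)"
        proof (rule eventually_at_filter[THEN iffD2], rule always_eventually, intro allI impI)
          fix t :: real assume t: "t \<noteq> 0"
          then have "(u (x + t *\<^sub>R ?e) - u x) /\<^sub>R t - partial j u x =
              (u (x + t *\<^sub>R ?e) - u x - t *\<^sub>R partial j u x) /\<^sub>R t"
            by (simp add: scaleR_diff_right)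
          then show "norm (u (x + t *\<^sub>R ?e) - u x - t *\<^sub>R partial j u x) / norm t =
            norm ((u (x + t *\<^sub>R ?e) - u x) /\<^sub>R t - partial j u x)"
            by (simp only: norm_scaleR) (simp add: divide_inverse mult.commute)
        qed
      qed
      then have "(\<lambda>t. (u (x + t *\<^sub>R ?e) - u x) /\<^sub>R t) \<midarrow>0\<rightarrow> partial j u x"
        by (simp add: tendsto_norm_zero_iff LIM_zero_iff)
      then show "(\<lambda>n. ?s n x) \<longlonglongrightarrow> partial j u x"
        by (rule filterlim_compose)
          (use LIMSEQ_inverse_real_of_nat in \<open>auto simp: filterlim_at simp del: of_nat_Suc\<close>)
    qed
    show "AE x in lborel. norm (?s n x) \<le> indicator (cball 0 (R + 1)) x *\<^sub>R B" for n
    proof (rule AE_I2)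
      fix x
      have h: "0 \<le> ?h n" "?h n \<le> 1" by (auto simp: field_simps)
      show "norm (?s n x) \<le> indicator (cball 0 (R + 1)) x *\<^sub>R B"
      proof (cases "x \<in> cball 0 (R + 1)")
        case True
        have b: "norm (u (x + ?h n *\<^sub>R ?e) - u x - ?h n *\<^sub>R 0) \<le> ?h n * B"
          using u B' h by (intro axis_increment_bound) auto
        have "norm (z /\<^sub>R k) \<le> B" if "norm z \<le> k * B" "0 < k" for z :: complex and k
          using that by (simp add: field_simps)
        from this[of _ "?h n"] b have "norm (?s n x) \<le> B"
          by (simp del: norm_scaleR of_nat_Suc)
        then show ?thesis using True by simp
      next
        case False
        then have "norm x > R + 1" by simp
        moreover have "norm (?h n *\<^sub>R ?e) \<le> 1" using h by (simp add: norm_axis_1)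
        ultimately have "norm (x + ?h n *\<^sub>R ?e) > R" "norm x > R"
          using norm_diff_ineq[of x "?h n *\<^sub>R ?e"] by linarith+
        then have "u (x + ?h n *\<^sub>R ?e) = 0" "u x = 0"
          using R K(2) by (meson not_le)+
        then show ?thesis using B by simp
      qed
    qed
  qed measurable
  moreover have "(\<integral>x. ?s n x \<partial>lborel) = 0" for n
  proof -
    let ?v = "?h n *\<^sub>R ?e"
    have eq: "(\<integral>x. u (?v + x) \<partial>lborel) = (\<integral>x. u x \<partial>lborel)"
      using integral_distr[of "(+) ?v" lborel borel u] by (simp add: lborel_distr_plus)
    have "integrable (distr lborel borel ((+) ?v)) u"
      using test_integrable[OF u] by (simp add: lborel_distr_plus)
    then have "integrable lborel (\<lambda>x. u (?v + x))"
      by (subst (asm) integrable_distr_eq) auto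
    then show ?thesis
      using eq test_integrable[OF u] by (simp add: add.commute)
  qed
  ultimately show ?thesis
    by (simp add: LIMSEQ_const_iff)
qed

section \<open>Radial and angular derivatives\<close>

text \<open>Complex-valued coefficients turn the operators into sums of products in a single field,
  so that ring simplification applies instead of rules for \<open>scaleR\<close>. Like
  \<open>dir\<close> below, it takes the value 0 at the origin.\<close>

definition inv_norm :: "real^'n::finite \<Rightarrow> complex"
  where "inv_norm x = of_real (inverse (norm x))"

definition dir :: "'n::finite \<Rightarrow> real^'n \<Rightarrow> complex"
  where "dir j x = of_real (x $ j / norm x)"

lemma cnj_inv_norm [simp]: "cnj (inv_norm x) = inv_norm x"
  by (simp add: inv_norm_def)

lemma radial_deriv_dir_sum: "radial_deriv u x = (\<Sum>j\<in>UNIV. dir j x * partial j u x)"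
  unfolding radial_deriv_def dir_def by (intro sum.cong refl) (rule scaleR_conv_of_real)

lemma angular_deriv_dir: "angular_deriv j u x = partial j u x - dir j x * radial_deriv u x"
  unfolding angular_deriv_def dir_def by (simp only: scaleR_conv_of_real)

lemma radial_laplacian_inv_norm:
  "radial_laplacian u x = radial_deriv (radial_deriv u) x
    + (of_nat CARD('n) - 1) * (inv_norm x * radial_deriv u x)"
  for u :: "real^'n::finite \<Rightarrow> complex"
  unfolding radial_laplacian_def inv_norm_def scaleR_conv_of_real by (simp add: divide_inverse)

lemma sum_dir_squares:
  assumes "x \<noteq> (0 :: real^'n::finite)"
  shows "(\<Sum>j\<in>UNIV. dir j x * dir j x) = 1"
proof -
  have "(\<Sum>j\<in>UNIV. (x $ j / norm x) * (x $ j / norm x)) = (x \<bullet> x) / (norm x)\<^sup>2"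
    by (simp add: inner_vec_def sum_divide_distrib power2_eq_square)
  then have "(\<Sum>j\<in>UNIV. (x $ j / norm x) * (x $ j / norm x)) = 1"
    using assms by (simp add: dot_square_norm)
  then show ?thesis
    unfolding dir_def of_real_mult[symmetric] of_real_sum[symmetric] by simp
qed

lemma test_inv_norm: "u \<in> test_functions \<Longrightarrow> (\<lambda>x. inv_norm x * u x) \<in> test_functions"
  using test_inverse_norm_power[of u 1] by (simp add: inv_norm_def)

lemma test_dir: "u \<in> test_functions \<Longrightarrow> (\<lambda>x. dir j x * u x) \<in> test_functions"
  using test_inv_norm[OF test_smooth_mult[OF smooth_coord, of u j]]
  by (simp add: inv_norm_def dir_def divide_inverse mult.commute mult.left_commute)

lemma test_radial: "u \<in> test_functions \<Longrightarrow> radial_deriv u \<in> test_functions"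
  unfolding radial_deriv_dir_sum[abs_def] by (intro test_sum test_dir test_partial)

lemma test_angular: "u \<in> test_functions \<Longrightarrow> angular_deriv j u \<in> test_functions"
  unfolding angular_deriv_dir[abs_def] by (intro test_diff test_dir test_partial test_radial)

lemmas test_intros = test_add test_diff test_mult test_cmult test_cnj test_partial test_inv_norm
  test_dir test_radial test_angular

lemma partial_inv_norm:
  assumes u: "u \<in> test_functions"
  shows "partial i (\<lambda>x. inv_norm x * u x) x
    = inv_norm x * partial i u x - inv_norm x * (inv_norm x * (dir i x * u x))"
  using test_inverse_norm_power_has_derivative(2)[OF u, of i 1 x]
  by (simp add: inv_norm_def dir_def power3_eq_cube divide_inverse)

lemma partial_dir:
  assumes u: "u \<in> test_functions"
  shows "partial i (\<lambda>x. dir j x * u x) x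
    = dir j x * partial i u x + inv_norm x * (((if i = j then 1 else 0) - dir i x * dir j x) * u x)"
proof (cases "x = 0")
  case True
  have "partial i (\<lambda>x. dir j x * u x) 0 = 0"
    by (intro test_zero test_intros u)
  then show ?thesis using True test_zero[OF u] by (simp add: dir_def)
next
  case False
  have d: "(dir j has_derivative (\<lambda>h. of_real (h $ j / norm x - x $ j * (x \<bullet> h) / norm x ^ 3))) (at x)"
    using has_derivative_of_real[OF has_derivative_direction[OF False], where 'a=complex]
    unfolding dir_def[abs_def] .
  have "partial i (\<lambda>x. dir j x * u x) x = partial i (dir j) x * u x + dir j x * partial i u x"
    using d by (intro partial_mult test_differentiable[OF u]) (auto simp: differentiable_def)
  moreover have "partial i (dir j) x = inv_norm x * ((if i = j then 1 else 0) - dir i x * dir j x)"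
  proof -
    have "x \<bullet> axis i 1 = x $ i" by (simp add: inner_axis)
    moreover have "axis i 1 $ j = (if i = j then 1 else 0 :: real)" by (simp add: axis_def)
    ultimately show ?thesis
      unfolding partial_eq[OF d] inv_norm_def dir_def
      using False by (auto simp: divide_simps power3_eq_cube)
  qed
  ultimately show ?thesis by (simp add: algebra_simps)
qed

lemma radial_deriv_add:
  "u \<in> test_functions \<Longrightarrow> v \<in> test_functions \<Longrightarrow>
    radial_deriv (\<lambda>x. u x + v x) x = radial_deriv u x + radial_deriv v x"
  by (simp add: radial_deriv_dir_sum partial_add distrib_left sum.distrib)

lemma radial_deriv_mult:
  "u \<in> test_functions \<Longrightarrow> v \<in> test_functions \<Longrightarrow>
    radial_deriv (\<lambda>x. u x * v x) x = radial_deriv u x * v x + u x * radial_deriv v x"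
  by (simp add: radial_deriv_dir_sum partial_mult distrib_left sum.distrib sum_distrib_left
      sum_distrib_right mult_ac)

lemma radial_deriv_cnj:
  "u \<in> test_functions \<Longrightarrow> radial_deriv (\<lambda>x. cnj (u x)) x = cnj (radial_deriv u x)"
  by (simp add: radial_deriv_dir_sum partial_cnj dir_def)

text \<open>At the origin all \<open>dir j\<close> are 0 and their squares do not add up to 1; the
  factor \<open>u\<close>, which vanishes there, repairs the identity.\<close>

lemma sum_dir_squares_mult:
  assumes "u \<in> test_functions"
  shows "(\<Sum>j\<in>UNIV. dir j x * (dir j x * u x)) = u x"
  using sum_dir_squares[of x] test_zero[OF assms]
  by (cases "x = 0") (simp_all add: mult.assoc[symmetric] sum_distrib_right[symmetric])

lemma radial_deriv_inv_norm:
  assumes "u \<in> test_functions"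
  shows "radial_deriv (\<lambda>x. inv_norm x * u x) x
    = inv_norm x * radial_deriv u x - inv_norm x * (inv_norm x * u x)"
proof -
  have "radial_deriv (\<lambda>x. inv_norm x * u x) x = inv_norm x * radial_deriv u x
      - inv_norm x * (inv_norm x * (\<Sum>j\<in>UNIV. dir j x * (dir j x * u x)))"
    using assms by (simp add: radial_deriv_dir_sum partial_inv_norm right_diff_distrib
        sum_subtractf sum_distrib_left mult_ac)
  then show ?thesis by (simp add: sum_dir_squares_mult[OF assms])
qed

text \<open>The direction x/|x| is constant along rays.\<close>

lemma radial_deriv_dir:
  assumes "u \<in> test_functions"
  shows "radial_deriv (\<lambda>x. dir j x * u x) x = dir j x * radial_deriv u x"
proof -
  have "radial_deriv (\<lambda>x. dir j x * u x) x = dir j x * radial_deriv u x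
      + (\<Sum>i\<in>UNIV. (if i = j then dir i x * (inv_norm x * u x) else 0))
      - dir j x * (inv_norm x * (\<Sum>i\<in>UNIV. dir i x * (dir i x * u x)))"
    unfolding radial_deriv_dir_sum sum_distrib_left sum.distrib[symmetric] sum_subtractf[symmetric]
    by (intro sum.cong refl, simp only: partial_dir[OF assms]) (auto simp: algebra_simps)
  then show ?thesis by (simp add: sum_dir_squares_mult[OF assms])
qed

lemma angular_deriv_add:
  "u \<in> test_functions \<Longrightarrow> v \<in> test_functions \<Longrightarrow>
    angular_deriv j (\<lambda>x. u x + v x) x = angular_deriv j u x + angular_deriv j v x"
  by (simp add: angular_deriv_dir partial_add radial_deriv_add algebra_simps)

lemma angular_deriv_mult:
  "u \<in> test_functions \<Longrightarrow> v \<in> test_functions \<Longrightarrow>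
    angular_deriv j (\<lambda>x. u x * v x) x = angular_deriv j u x * v x + u x * angular_deriv j v x"
  by (simp add: angular_deriv_dir partial_mult radial_deriv_mult algebra_simps)

lemma angular_deriv_cmult:
  "u \<in> test_functions \<Longrightarrow> angular_deriv j (\<lambda>x. c * u x) x = c * angular_deriv j u x"
  using smooth_const[of c, unfolded smooth_def, rule_format, of "Suc 0"]
  by (simp add: angular_deriv_dir radial_deriv_dir_sum partial_mult partial_const
      sum_distrib_left algebra_simps)

lemma angular_deriv_cnj:
  "u \<in> test_functions \<Longrightarrow> angular_deriv j (\<lambda>x. cnj (u x)) x = cnj (angular_deriv j u x)"
  by (simp add: angular_deriv_dir partial_cnj radial_deriv_cnj) (simp add: dir_def)

text \<open>The angular derivatives are tangent to the spheres on which |x| is constant.\<close>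

lemma angular_deriv_inv_norm:
  "u \<in> test_functions \<Longrightarrow>
    angular_deriv j (\<lambda>x. inv_norm x * u x) x = inv_norm x * angular_deriv j u x"
  by (simp add: angular_deriv_dir partial_inv_norm radial_deriv_inv_norm algebra_simps)

text \<open>L_j is 1/|x| times an operator in the angular variable alone, and differentiating that
  factor radially produces the commutator. In coordinates it arises from differentiating the
  coefficients x_k/|x|, once the second derivatives of \<open>u\<close> have been
  interchanged.\<close>

lemma angular_radial_commute:
  assumes u: "u \<in> test_functions"
  shows "angular_deriv j (radial_deriv u) x
    = radial_deriv (angular_deriv j u) x + inv_norm x * angular_deriv j u x"
proof -
  have psum: "partial j (radial_deriv u) x = (\<Sum>k\<in>UNIV. partial j (\<lambda>x. dir k x * partial k u x) x)"
  proof -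
    have "((\<lambda>x. \<Sum>k\<in>UNIV. dir k x * partial k u x) has_derivative
        (\<lambda>h. \<Sum>k\<in>UNIV. frechet_derivative (\<lambda>x. dir k x * partial k u x) (at x) h)) (at x)"
      by (intro has_derivative_sum differentiable_has_partials test_differentiable test_intros u)
    from partial_eq[OF this] show ?thesis
      by (simp add: radial_deriv_dir_sum[abs_def] partial_def)
  qed
  have "partial j (radial_deriv u) x = radial_deriv (partial j u) x
      + (\<Sum>k\<in>UNIV. (if k = j then inv_norm x * partial k u x else 0))
      - inv_norm x * (dir j x * radial_deriv u x)"
    unfolding psum radial_deriv_dir_sum sum_distrib_left sum.distrib[symmetric] sum_subtractf[symmetric]
  proof (intro sum.cong refl)
    fix k
    show "partial j (\<lambda>x. dir k x * partial k u x) x = dir k x * partial k (partial j u) x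
        + (if k = j then inv_norm x * partial k u x else 0)
        - inv_norm x * (dir j x * (dir k x * partial k u x))"
      using partial_commute[OF test_Ck[OF u], of j k x]
      by (simp only: partial_dir[OF test_partial[OF u]]) (auto simp: algebra_simps)
  qed
  then have 1: "partial j (radial_deriv u) x
      = radial_deriv (partial j u) x + inv_norm x * angular_deriv j u x"
    by (simp add: angular_deriv_dir algebra_simps)
  \<comment> \<open>This differentiates the decomposition of \<open>partial j u\<close> along the
    ray, where \<open>dir j\<close> acts as a constant.\<close>
  have "radial_deriv (\<lambda>x. angular_deriv j u x + dir j x * radial_deriv u x) x
      = radial_deriv (angular_deriv j u) x + dir j x * radial_deriv (radial_deriv u) x"
    using u by (simp add: radial_deriv_add radial_deriv_dir test_intros)
  moreover have "(\<lambda>x. angular_deriv j u x + dir j x * radial_deriv u x) = partial j u"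
    by (simp add: fun_eq_iff angular_deriv_dir)
  ultimately show ?thesis
    using 1 by (simp add: angular_deriv_dir[of j "radial_deriv u"])
qed

text \<open>The L_j u are the components of the tangential gradient, which is orthogonal to
  x/|x|.\<close>

lemma sum_dir_angular:
  assumes "u \<in> test_functions"
  shows "(\<Sum>j\<in>UNIV. dir j x * angular_deriv j u x) = 0"
  using sum_dir_squares_mult[OF test_radial[OF assms]]
  by (simp add: angular_deriv_dir right_diff_distrib sum_subtractf radial_deriv_dir_sum[symmetric])

section \<open>Integration by parts for radial and angular derivatives\<close>

lemma integral_radial_deriv:
  fixes u :: "real^'n::finite \<Rightarrow> complex"
  assumes u: "u \<in> test_functions"
  shows "(\<integral>x. radial_deriv u x \<partial>lborel) = (1 - of_nat CARD('n)) * (\<integral>x. inv_norm x * u x \<partial>lborel)"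
proof -
  \<comment> \<open>The zeroth-order term comes from div(x/|x|) = (n-1)/|x|: the Kronecker deltas
    contribute n and the squares of \<open>dir\<close> remove 1.\<close>
  have "(\<Sum>j\<in>UNIV. partial j (\<lambda>x. dir j x * u x) x)
      = radial_deriv u x + (of_nat CARD('n) - 1) * (inv_norm x * u x)" for x
  proof -
    have "(\<Sum>j\<in>UNIV. partial j (\<lambda>x. dir j x * u x) x) = radial_deriv u x
      + (\<Sum>j\<in>(UNIV :: 'n set). inv_norm x * u x) - inv_norm x * (\<Sum>j\<in>UNIV. dir j x * (dir j x * u x))"
      unfolding radial_deriv_dir_sum sum_distrib_left sum.distrib[symmetric] sum_subtractf[symmetric]
      by (intro sum.cong refl, simp only: partial_dir[OF u]) (auto simp: algebra_simps)
    then show ?thesis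
      by (simp only: sum_dir_squares_mult[OF u]) (simp add: algebra_simps)
  qed
  then have "(\<integral>x. radial_deriv u x + (of_nat CARD('n) - 1) * (inv_norm x * u x) \<partial>lborel)
      = (\<integral>x. (\<Sum>j\<in>UNIV. partial j (\<lambda>x. dir j x * u x) x) \<partial>lborel)"
    by simp
  also have "\<dots> = (\<Sum>j\<in>UNIV. \<integral>x. partial j (\<lambda>x. dir j x * u x) x \<partial>lborel)"
    by (intro Bochner_Integration.integral_sum test_integrable test_intros u)
  also have "\<dots> = 0"
    by (intro sum.neutral ballI integral_partial_eq_0 test_intros u)
  finally show ?thesis
    using u by (simp add: test_integrable test_intros add_eq_0_iff2) (simp add: algebra_simps)
qed

text \<open>Since \<open>dir j\<close> is constant along rays, L_j u is the derivative
  \<open>partial j u\<close>, which integrates to 0, minus the radial derivative of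
  \<open>dir j\<close> times \<open>u\<close>. The remaining integral reflects the curvature of the
  spheres.\<close>

lemma integral_angular_deriv:
  fixes u :: "real^'n::finite \<Rightarrow> complex"
  assumes u: "u \<in> test_functions"
  shows "(\<integral>x. angular_deriv j u x \<partial>lborel)
    = (of_nat CARD('n) - 1) * (\<integral>x. inv_norm x * (dir j x * u x) \<partial>lborel)"
proof -
  have "(\<integral>x. angular_deriv j u x \<partial>lborel)
      = (\<integral>x. partial j u x - radial_deriv (\<lambda>x. dir j x * u x) x \<partial>lborel)"
    by (simp add: angular_deriv_dir radial_deriv_dir[OF u])
  also have "\<dots> = - (\<integral>x. radial_deriv (\<lambda>x. dir j x * u x) x \<partial>lborel)"
    using u by (simp add: test_integrable test_intros integral_partial_eq_0)
  finally show ?thesis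
    using u by (simp add: integral_radial_deriv test_intros) (simp add: algebra_simps)
qed

lemma test_spherical_laplacian: "f \<in> test_functions \<Longrightarrow> spherical_laplacian f \<in> test_functions"
  unfolding spherical_laplacian_def[abs_def] by (intro test_sum test_intros)

lemma test_radial_laplacian: "f \<in> test_functions \<Longrightarrow> radial_laplacian f \<in> test_functions"
  unfolding radial_laplacian_inv_norm[abs_def] by (intro test_intros)

lemma l2_inner_spherical_laplacian:
  fixes f u :: "real^'n::finite \<Rightarrow> complex"
  assumes f: "f \<in> test_functions" and u: "u \<in> test_functions"
  shows "l2_inner u (spherical_laplacian f)
    = - (\<Sum>j\<in>UNIV. l2_inner (angular_deriv j u) (angular_deriv j f))"
proof -
  let ?w = "\<lambda>j x. u x * cnj (angular_deriv j f x)"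
  have w: "?w j \<in> test_functions" for j by (intro test_intros f u)
  have "l2_inner u (spherical_laplacian f) + (\<Sum>j\<in>UNIV. l2_inner (angular_deriv j u) (angular_deriv j f))
      = (\<Sum>j\<in>UNIV. \<integral>x. angular_deriv j (?w j) x \<partial>lborel)"
  proof -
    have "l2_inner u (spherical_laplacian f)
        = (\<Sum>j\<in>UNIV. \<integral>x. u x * cnj (angular_deriv j (angular_deriv j f) x) \<partial>lborel)"
      unfolding l2_inner_def spherical_laplacian_def cnj_sum sum_distrib_left
      by (intro Bochner_Integration.integral_sum test_integrable test_intros f u)
    then show ?thesis
      unfolding l2_inner_def using f u
      by (simp add: angular_deriv_mult angular_deriv_cnj test_intros test_integrable
          sum.distrib)
  qed
  also have "\<dots> = (of_nat CARD('n) - 1) *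
      (\<integral>x. (\<Sum>j\<in>UNIV. inv_norm x * (dir j x * ?w j x)) \<partial>lborel)"
    unfolding integral_angular_deriv[OF w]
    by (subst Bochner_Integration.integral_sum)
      (intro test_integrable test_intros f u, simp only: sum_distrib_left)
  also have "(\<lambda>x. \<Sum>j\<in>UNIV. inv_norm x * (dir j x * ?w j x)) = (\<lambda>_. 0)"
  proof
    fix x
    have "(\<Sum>j\<in>UNIV. inv_norm x * (dir j x * ?w j x))
        = inv_norm x * u x * cnj (\<Sum>j\<in>UNIV. dir j x * angular_deriv j f x)"
      by (simp add: sum_distrib_left dir_def mult_ac)
    then show "(\<Sum>j\<in>UNIV. inv_norm x * (dir j x * ?w j x)) = 0"
      by (simp add: sum_dir_angular[OF f])
  qed
  finally show ?thesis by (simp add: add_eq_0_iff2)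
qed

section \<open>The radial form and its sign\<close>

lemma angular_deriv_radial_laplacian:
  fixes f :: "real^'n::finite \<Rightarrow> complex" and j :: 'n
  assumes f: "f \<in> test_functions"
  defines "w \<equiv> angular_deriv j f"
  shows "angular_deriv j (radial_laplacian f) x = radial_deriv (radial_deriv w) x
    + (of_nat CARD('n) + 1) * (inv_norm x * radial_deriv w x)
    + (of_nat CARD('n) - 1) * (inv_norm x * (inv_norm x * w x))"
proof -
  have w: "w \<in> test_functions" unfolding w_def by (intro test_intros f)
  have 1: "angular_deriv j (radial_deriv f) = (\<lambda>x. radial_deriv w x + inv_norm x * w x)"
    by (simp add: fun_eq_iff w_def angular_radial_commute[OF f])
  \<comment> \<open>Commuting twice yields (dr + 1/|x|)^2 w. Its zeroth-order terms -1/|x|^2 and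
    1/|x|^2 cancel, and the remaining first-order coefficient 2 raises n - 1 to n + 1 below.\<close>
  have 2: "angular_deriv j (radial_deriv (radial_deriv f)) x = radial_deriv (radial_deriv w) x
      + 2 * (inv_norm x * radial_deriv w x)"
    using w by (simp add: angular_radial_commute[OF test_radial[OF f]] 1 radial_deriv_add
        radial_deriv_inv_norm test_intros algebra_simps)
  have "angular_deriv j (radial_laplacian f) x = angular_deriv j (radial_deriv (radial_deriv f)) x
      + (of_nat CARD('n) - 1) * (inv_norm x * angular_deriv j (radial_deriv f) x)"
    unfolding radial_laplacian_inv_norm[abs_def] using f
    by (simp add: angular_deriv_add angular_deriv_cmult angular_deriv_inv_norm test_intros)
  then show ?thesis unfolding 2 1 by (simp add: algebra_simps)
qed

lemma Re_radial_form_nonpos: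
  fixes w :: "real^'n::finite \<Rightarrow> complex"
  assumes w: "w \<in> test_functions" and n: "CARD('n) \<ge> 4"
  shows "Re (\<integral>x. (radial_deriv (radial_deriv w) x
    + (of_nat CARD('n) + 1) * (inv_norm x * radial_deriv w x)
    + (of_nat CARD('n) - 1) * (inv_norm x * (inv_norm x * w x))) * cnj (w x) \<partial>lborel) \<le> 0"
proof -
  let ?N = "of_nat CARD('n) :: complex"
  \<comment> \<open>\<open>?div u\<close> is the divergence of $u\,x/|x|$. Up to divergences and the imaginary
    \<open>?H x - cnj (?H x)\<close>, the integrand is $-|\partial_r w + w/|x||^2 - (n-4)|w|^2/|x|^2$.\<close>
  let ?F = "\<lambda>x. radial_deriv w x * cnj (w x)"
  let ?G = "\<lambda>x. inv_norm x * (w x * cnj (w x))"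
  let ?H = "\<lambda>x. inv_norm x * (radial_deriv w x * cnj (w x))"
  let ?v = "\<lambda>x. radial_deriv w x + inv_norm x * w x"
  let ?V = "\<lambda>x. ?v x * cnj (?v x)"
  let ?W = "\<lambda>x. (inv_norm x * w x) * cnj (inv_norm x * w x)"
  let ?div = "\<lambda>u x. radial_deriv u x + (?N - 1) * (inv_norm x * u x)"
  have T: "?F \<in> test_functions" "?G \<in> test_functions" "?H \<in> test_functions"
    "?V \<in> test_functions" "?W \<in> test_functions"
    by (intro test_intros w)+
  have divT: "?div u \<in> test_functions" if "u \<in> test_functions" for u :: "real^'n \<Rightarrow> complex"
    by (intro test_intros that)
  have div0: "(\<integral>x. ?div u x \<partial>lborel) = 0" if "u \<in> test_functions" for u :: "real^'n \<Rightarrow> complex"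
    using that integral_radial_deriv[OF that]
    by (simp add: test_integrable test_intros) (simp add: algebra_simps)
  \<comment> \<open>Removing the divergence of \<open>?F\<close> and the imaginary part leaves -|dr
    w|^2 + 2 Re \<open>?H\<close> + (n-1) \<open>?W\<close>. Completing the square gives
    -\<open>?V\<close> + 4 Re \<open>?H\<close> + n \<open>?W\<close>. Twice the divergence of
    \<open>?G\<close> is 4 Re \<open>?H\<close> + 2(n-2) \<open>?W\<close>, so \<open>?W\<close>
    keeps the coefficient n - 2(n-2) = 4 - n.\<close>
  have eq: "(radial_deriv (radial_deriv w) x
      + (?N + 1) * (inv_norm x * radial_deriv w x)
      + (?N - 1) * (inv_norm x * (inv_norm x * w x))) * cnj (w x)
      = ?div ?F x + 2 * ?div ?G x + (?H x - cnj (?H x)) - (?V x + (?N - 4) * ?W x)" for x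
    using w by (simp add: radial_deriv_mult radial_deriv_cnj radial_deriv_inv_norm test_intros
        algebra_simps)
  have pos: "0 \<le> Re (\<integral>x. u x * cnj (u x) \<partial>lborel)" for u :: "real^'n \<Rightarrow> complex"
  proof -
    have "(\<integral>x. u x * cnj (u x) \<partial>lborel) = (\<integral>x. complex_of_real ((cmod (u x))\<^sup>2) \<partial>lborel)"
      by (simp only: complex_norm_square)
    also have "\<dots> = of_real (\<integral>x. (cmod (u x))\<^sup>2 \<partial>lborel)"
      by (rule integral_complex_of_real)
    finally show ?thesis by (simp add: integral_nonneg)
  qed
  \<comment> \<open>Linearity is stated for opaque functions so that the simplifier splits the
    integral only at this level and leaves the divergences and squares intact.\<close>
  have int: "(\<integral>x. a x + 2 * b x + (c x - d x) - (e x + k * g x) \<partial>lborel)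
      = (\<integral>x. a x \<partial>lborel) + 2 * (\<integral>x. b x \<partial>lborel) + ((\<integral>x. c x \<partial>lborel) - (\<integral>x. d x \<partial>lborel))
        - ((\<integral>x. e x \<partial>lborel) + k * (\<integral>x. g x \<partial>lborel))"
    if "a \<in> test_functions" "b \<in> test_functions" "c \<in> test_functions" "d \<in> test_functions"
      "e \<in> test_functions" "g \<in> test_functions" for a b c d e g :: "real^'n \<Rightarrow> complex" and k
    using that by (simp add: test_integrable test_intros)
  have "(\<integral>x. ?div ?F x + 2 * ?div ?G x + (?H x - cnj (?H x)) - (?V x + (?N - 4) * ?W x) \<partial>lborel)
      = (\<integral>x. ?div ?F x \<partial>lborel) + 2 * (\<integral>x. ?div ?G x \<partial>lborel)
        + ((\<integral>x. ?H x \<partial>lborel) - (\<integral>x. cnj (?H x) \<partial>lborel))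
        - ((\<integral>x. ?V x \<partial>lborel) + (?N - 4) * (\<integral>x. ?W x \<partial>lborel))"
    by (intro int divT T test_cnj)
  also have "Re \<dots> \<le> 0"
  proof -
    have "0 \<le> (real CARD('n) - 4) * Re (\<integral>x. ?W x \<partial>lborel)"
      using pos[of "\<lambda>x. inv_norm x * w x"] n by (intro mult_nonneg_nonneg) auto
    moreover have "Re (\<integral>x. cnj (?H x) \<partial>lborel) = Re (\<integral>x. ?H x \<partial>lborel)"
      unfolding integral_Re[OF test_integrable[OF T(3)], symmetric]
        integral_Re[OF test_integrable[OF test_cnj[OF T(3)]], symmetric] cnj.sel ..
    moreover have "Re ((?N - 4) * z) = (real CARD('n) - 4) * Re z" for z
      by simp
    ultimately show ?thesis
      unfolding div0[OF T(1)] div0[OF T(2)] using pos[of ?v]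
      by (simp only: plus_complex.sel minus_complex.sel) simp
  qed
  finally show ?thesis unfolding eq .
qed

lemma Re_l2_inner_radial_spherical_nonneg:
  fixes f :: "real^'n::finite \<Rightarrow> complex"
  assumes f: "f \<in> test_functions" and n: "CARD('n) \<ge> 4"
  shows "Re (l2_inner (radial_laplacian f) (spherical_laplacian f)) \<ge> 0"
proof -
  have "Re (l2_inner (angular_deriv j (radial_laplacian f)) (angular_deriv j f)) \<le> 0" for j
    unfolding l2_inner_def angular_deriv_radial_laplacian[OF f]
    by (intro Re_radial_form_nonpos test_intros f n)
  then show ?thesis
    unfolding l2_inner_spherical_laplacian[OF f test_radial_laplacian[OF f]]
    by (simp add: sum_nonpos)
qed

section \<open>From the inner product to the norm inequality\<close>

lemma l2_norm_add_squared:
  fixes u v :: "real^'n::finite \<Rightarrow> complex"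
  assumes "u \<in> test_functions" "v \<in> test_functions"
  shows "(l2_norm (\<lambda>x. u x + v x))\<^sup>2 = (l2_norm u)\<^sup>2 + (l2_norm v)\<^sup>2 + 2 * Re (l2_inner u v)"
proof -
  have sq: "(l2_norm w)\<^sup>2 = (\<integral>x. (cmod (w x))\<^sup>2 \<partial>lborel)" for w :: "real^'n \<Rightarrow> complex"
    by (simp add: l2_norm_def integral_nonneg)
  have eq: "(cmod (a + b))\<^sup>2 = (cmod a)\<^sup>2 + (cmod b)\<^sup>2 + 2 * Re (a * cnj b)" for a b
    by (simp add: cmod_power2 power2_sum)
  have Re_int: "integrable lborel (\<lambda>x. Re (w x * cnj (z x)))"
    if "w \<in> test_functions" "z \<in> test_functions" for w z :: "real^'n \<Rightarrow> complex"
    using that by (intro integrable_Re test_integrable test_intros)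
  have cmod_int: "integrable lborel (\<lambda>x. (cmod (w x))\<^sup>2)"
    if "w \<in> test_functions" for w :: "real^'n \<Rightarrow> complex"
    using Re_int[OF that that] by (simp add: cmod_power2) (simp add: power2_eq_square)
  have "Re (l2_inner u v) = (\<integral>x. Re (u x * cnj (v x)) \<partial>lborel)"
    unfolding l2_inner_def using assms by (intro integral_Re[symmetric] test_integrable test_intros)
  then show ?thesis
    unfolding sq eq using assms Re_int[OF assms] cmod_int by (simp del: complex_cnj_mult times_complex.sel)
qed

text \<open>Away from the origin this is \<open>laplacian_split\<close>; at the origin both sides
  vanish, being values of test functions.\<close>

lemma laplacian_eq_radial_add_spherical:
  assumes f: "f \<in> test_functions"
  shows "laplacian f = (\<lambda>x. radial_laplacian f x + spherical_laplacian f x)"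
proof
  fix x
  have "laplacian f \<in> test_functions"
    unfolding laplacian_def[abs_def] by (intro test_sum test_intros f)
  then show "laplacian f x = radial_laplacian f x + spherical_laplacian f x"
    using laplacian_split[OF test_Ck[OF f]] f
    by (cases "x = 0") (simp_all add: test_zero test_radial_laplacian test_spherical_laplacian)
qed

theorem theorem1p1:
  fixes f :: "real^'n::finite \<Rightarrow> complex"
  assumes "CARD('n) \<ge> 4"
    and "f \<in> test_functions"
  shows "Re (l2_inner (radial_laplacian f) (spherical_laplacian f)) \<ge> 0 \<and>
    (l2_norm (laplacian f))\<^sup>2 \<ge> (l2_norm (radial_laplacian f))\<^sup>2 + (l2_norm (spherical_laplacian f))\<^sup>2"
  using Re_l2_inner_radial_spherical_nonneg[OF assms(2,1)]
    l2_norm_add_squared[OF test_radial_laplacian test_spherical_laplacian, OF assms(2,2)]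
  by (simp add: laplacian_eq_radial_add_spherical[OF assms(2)])

end
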